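(* Let $T\ge 1$, $d\ge1$, and let $C_1,\dots,C_T\subset\{0,1\}^d$ be nonempty constituent codes of a $T$-user uniquely decodable code with sum rate $R$. Suppose that there exists $j$ such that $\overline{\mathrm{wt}}(C_j)\ne d/2$. Then there exist a positive integer $n$ and constituent codes $C_1^*,\dots,C_T^*\subset\{0,1\}^{dn}$ such that $C_1^*,\dots,C_T^*$ is a $T$-user uniquely decodable code with sum rate strictly larger than $R$.
   Context: A $T$-user code in dimension $m$ consists of constituent codes $C_1,\dots,C_T\subset\{0,1\}^m$. It is uniquely decodable (UD) if for every $x\in\mathbb{Z}^m$ there is at most one tuple $(u_1,\dots,u_T)$ with $u_i\in C_i$ and $u_1+\dots+u_T=x$, where addition is in $\mathbb{Z}^m$. Its sum rate is $\frac1m\log_2\prod_{i=1}^T|C_i|$. For a binary vector $x$, $\mathrm{wt}(x)$ is its Hamming weight, and for a nonempty code $C$, $\overline{\mathrm{wt}}(C)$ is the average Hamming weight of the vectors in $C$. *)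

theory Defs
  imports Complex_Main "HOL-Library.FuncSet"
begin

text \<open>
  Vectors of length \<open>m\<close> and tuples indexed by \<open>{1..T}\<close> are extensional functions, so that equality
  of functions is equality of vectors (of tuples).
\<close>

definition int_vectors :: "nat \<Rightarrow> (nat \<Rightarrow> int) set" where
  "int_vectors m = {1..m} \<rightarrow>\<^sub>E UNIV"

definition binary_vectors :: "nat \<Rightarrow> (nat \<Rightarrow> int) set" where
  "binary_vectors m = {1..m} \<rightarrow>\<^sub>E {0, 1}"

definition vector_sum :: "nat \<Rightarrow> nat \<Rightarrow> (nat \<Rightarrow> nat \<Rightarrow> int) \<Rightarrow> nat \<Rightarrow> int" where
  "vector_sum m T u = (\<lambda>k\<in>{1..m}. \<Sum>i=1..T. u i k)"

definition user_code :: "nat \<Rightarrow> nat \<Rightarrow> (nat \<Rightarrow> (nat \<Rightarrow> int) set) \<Rightarrow> bool" where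
  "user_code m T C \<longleftrightarrow> (\<forall>i\<in>{1..T}. C i \<subseteq> binary_vectors m)"

definition uniquely_decodable :: "nat \<Rightarrow> nat \<Rightarrow> (nat \<Rightarrow> (nat \<Rightarrow> int) set) \<Rightarrow> bool" where
  "uniquely_decodable m T C \<longleftrightarrow>
    (\<forall>x\<in>int_vectors m. \<exists>\<^sub>\<le>\<^sub>1u. u \<in> (\<Pi>\<^sub>E i\<in>{1..T}. C i) \<and> vector_sum m T u = x)"

text \<open>
  As \<open>log 2 0 = 0\<close>, a code with an empty constituent gets sum rate \<open>0\<close> instead of \<open>-\<infinity>\<close>. The sum rate
  is nonnegative when all constituents are nonempty, so that value never exceeds the sum rate of a
  code with nonempty constituents.
\<close>

definition sum_rate :: "nat \<Rightarrow> nat \<Rightarrow> (nat \<Rightarrow> (nat \<Rightarrow> int) set) \<Rightarrow> real" where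
  "sum_rate m T C = 1 / real m * log 2 (\<Prod>i=1..T. real (card (C i)))"

definition hamming_weight :: "nat \<Rightarrow> (nat \<Rightarrow> int) \<Rightarrow> nat" where
  "hamming_weight m x = card {k \<in> {1..m}. x k \<noteq> 0}"

definition average_weight :: "nat \<Rightarrow> (nat \<Rightarrow> int) set \<Rightarrow> real" where
  "average_weight m C = (\<Sum>x\<in>C. real (hamming_weight m x)) / real (card C)"

end

theory Submission
  imports Defs
begin

text \<open>
  Complementing all words of one constituent preserves unique decodability: in an equation between
  two sums the two complemented words can be moved to the other side and thereby uncomplemented.
  Pass to the \<open>n\<close>-fold product code and keep in each constituent only the words whose weight is within
  \<open>\<epsilon> n\<close> of the mean; by Chebyshev's inequality this costs an arbitrarily small fraction of the words.
  If the mean weight of user \<open>j\<close> is not \<open>d n / 2\<close>, then the weight of the received sum reveals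
  whether user \<open>j\<close> sent a typical word or the complement of one, so adding all complements keeps the
  code uniquely decodable and doubles constituent \<open>j\<close>.
\<close>

section \<open>Unique decodability as injectivity, weights as coordinate sums\<close>

lemma finite_binary_vectors: "finite (binary_vectors m)"
  unfolding binary_vectors_def by (intro finite_PiE) auto

text \<open>Every \<open>vector_sum\<close> lies in \<open>int_vectors\<close>, so having at most
  one decoding of each received vector means that the sum map is injective. Equality of sums is
  spelled out per coordinate, which keeps \<open>restrict\<close> out of later arguments.\<close>

lemma uniquely_decodable_iff:
  "uniquely_decodable m T C \<longleftrightarrow>
    (\<forall>u\<in>\<Pi>\<^sub>E i\<in>{1..T}. C i. \<forall>v\<in>\<Pi>\<^sub>E i\<in>{1..T}. C i.
      (\<forall>k\<in>{1..m}. (\<Sum>i=1..T. u i k) = (\<Sum>i=1..T. v i k)) \<longrightarrow> u = v)"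
proof -
  have *: "vector_sum m T u \<in> int_vectors m" for u
    unfolding vector_sum_def int_vectors_def by auto
  have **: "vector_sum m T u = vector_sum m T v \<longleftrightarrow>
      (\<forall>k\<in>{1..m}. (\<Sum>i=1..T. u i k) = (\<Sum>i=1..T. v i k))" for u v
    unfolding vector_sum_def by (auto simp: restrict_def fun_eq_iff)
  show ?thesis
    unfolding uniquely_decodable_def Uniq_def **[symmetric] using * by blast
qed

lemma uniquely_decodableD:
  assumes "uniquely_decodable m T C"
    and "u \<in> (\<Pi>\<^sub>E i\<in>{1..T}. C i)" and "v \<in> (\<Pi>\<^sub>E i\<in>{1..T}. C i)"
    and "\<And>k. k \<in> {1..m} \<Longrightarrow> (\<Sum>i=1..T. u i k) = (\<Sum>i=1..T. v i k)"
  shows "u = v"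
  using assms unfolding uniquely_decodable_iff by blast

lemma uniquely_decodable_mono:
  assumes "uniquely_decodable m T C" and "\<And>i. i \<in> {1..T} \<Longrightarrow> A i \<subseteq> C i"
  shows "uniquely_decodable m T A"
proof -
  have "(\<Pi>\<^sub>E i\<in>{1..T}. A i) \<subseteq> (\<Pi>\<^sub>E i\<in>{1..T}. C i)"
    using assms(2) by (rule PiE_mono)
  then show ?thesis
    using assms(1) unfolding uniquely_decodable_iff by blast
qed

text \<open>Weight becomes linear on binary words; this is what makes the total weight of all sent
  words visible in their sum.\<close>

lemma hamming_weight_binary:
  assumes "x \<in> binary_vectors m"
  shows "int (hamming_weight m x) = (\<Sum>k=1..m. x k)"
proof -
  have "(\<Sum>k=1..m. x k) = (\<Sum>k=1..m. if x k \<noteq> 0 then 1 else 0)"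
    using assms by (intro sum.cong) (auto simp: binary_vectors_def PiE_def Pi_def)
  also have "\<dots> = int (card {k \<in> {1..m}. x k \<noteq> 0})"
    by (simp add: sum.If_cases Int_def)
  finally show ?thesis
    by (simp add: hamming_weight_def)
qed

lemma hamming_weight_le: "hamming_weight m x \<le> m"
proof -
  have "card {k \<in> {1..m}. x k \<noteq> 0} \<le> card {1..m}"
    by (intro card_mono) auto
  then show ?thesis
    by (simp add: hamming_weight_def)
qed

subsection \<open>Complements\<close>

definition complement_vector :: "nat \<Rightarrow> (nat \<Rightarrow> int) \<Rightarrow> nat \<Rightarrow> int" where
  "complement_vector m x = (\<lambda>k\<in>{1..m}. 1 - x k)"

lemma complement_binary:
  "x \<in> binary_vectors m \<Longrightarrow> complement_vector m x \<in> binary_vectors m"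
  unfolding complement_vector_def binary_vectors_def
  by (auto simp: PiE_iff)

lemma complement_complement:
  "x \<in> binary_vectors m \<Longrightarrow> complement_vector m (complement_vector m x) = x"
  by (auto simp: complement_vector_def binary_vectors_def fun_eq_iff PiE_iff extensional_def)

lemma hamming_weight_complement:
  assumes "x \<in> binary_vectors m"
  shows "real (hamming_weight m (complement_vector m x)) = real m - real (hamming_weight m x)"
proof -
  have "int (hamming_weight m (complement_vector m x)) = (\<Sum>k=1..m. 1 - x k)"
    unfolding hamming_weight_binary[OF complement_binary[OF assms]]
    by (simp add: complement_vector_def)
  also have "\<dots> = int m - int (hamming_weight m x)"
    by (simp add: hamming_weight_binary[OF assms] sum_subtractf)
  finally show ?thesis
    by linarith
qed

text \<open>Complementation is an involution on binary vectors, hence injective.\<close>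

lemma card_Un_complement:
  assumes "A \<subseteq> binary_vectors m"
    and "A \<inter> complement_vector m ` A = {}"
  shows "card (A \<union> complement_vector m ` A) = 2 * card A"
proof -
  have "inj_on (complement_vector m) A"
    using assms(1) by (intro inj_on_inverseI[of _ "complement_vector m"]) (auto simp: complement_complement)
  moreover have "finite A"
    using assms(1) finite_binary_vectors by (rule finite_subset)
  ultimately show ?thesis
    using assms(2) by (simp add: card_Un_disjoint card_image)
qed

text \<open>If two tuples with equal sums both use complemented words at \<open>j\<close>, or
  neither does, they reduce to tuples of \<open>A\<close>. If exactly one does, equal total weights
  force the weight change at \<open>j\<close> to be balanced by the other \<open>T - 1\<close>
  users, who can shift it by at most \<open>2 * e\<close> each; the gap forbids this.\<close>

lemma uniquely_decodable_Un_complement: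
  assumes A: "user_code m T A" and ud: "uniquely_decodable m T A" and j: "j \<in> {1..T}"
    and e: "\<And>i x. i \<in> {1..T} \<Longrightarrow> x \<in> A i \<Longrightarrow> \<bar>real (hamming_weight m x) - w i\<bar> \<le> e"
    and gap: "2 * real T * e < \<bar>real m - 2 * w j\<bar>"
  shows "uniquely_decodable m T (A(j := A j \<union> complement_vector m ` A j))"
proof -
  let ?c = "complement_vector m" and ?h = "\<lambda>x. real (hamming_weight m x)"
  let ?B = "A(j := A j \<union> ?c ` A j)"
  have bin: "x \<in> binary_vectors m" if "i \<in> {1..T}" "x \<in> A i" for i x
    using A that by (auto simp: user_code_def)
  have binB: "x \<in> binary_vectors m" if "i \<in> {1..T}" "x \<in> ?B i" for i x
    using that bin complement_binary by (auto split: if_splits)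
  have mixed: False
    if u: "u \<in> (\<Pi>\<^sub>E i\<in>{1..T}. ?B i)" and v: "v \<in> (\<Pi>\<^sub>E i\<in>{1..T}. ?B i)"
      and eq: "\<And>k. k \<in> {1..m} \<Longrightarrow> (\<Sum>i=1..T. u i k) = (\<Sum>i=1..T. v i k)"
      and uj: "u j \<in> A j" and y: "y \<in> A j" "v j = ?c y" for u v y
  proof -
    \<comment> \<open>Exchanging the two sums shows that the total weight depends only on the
      received vector.\<close>
    have w: "(\<Sum>i=1..T. ?h (z i)) = real_of_int (\<Sum>k=1..m. \<Sum>i=1..T. z i k)"
      if z: "z \<in> (\<Pi>\<^sub>E i\<in>{1..T}. ?B i)" for z
    proof -
      have "(\<Sum>i=1..T. int (hamming_weight m (z i))) = (\<Sum>i=1..T. \<Sum>k=1..m. z i k)"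
        using z binB by (intro sum.cong hamming_weight_binary) (auto dest!: PiE_mem)
      also have "\<dots> = (\<Sum>k=1..m. \<Sum>i=1..T. z i k)"
        by (rule sum.swap)
      finally show ?thesis
        by (simp flip: of_int_sum) (metis of_int_of_nat_eq of_int_sum of_nat_sum)
    qed
    have "(\<Sum>i=1..T. ?h (u i)) = (\<Sum>i=1..T. ?h (v i))"
      using eq unfolding w[OF u] w[OF v] by simp
    \<comment> \<open>User \<open>j\<close> is isolated. The right side is
      \<open>real m - ?h y - ?h (u j)\<close>, which is within \<open>2 * e\<close> of
      \<open>real m - 2 * w j\<close>, while the left side is at most \<open>2 * (T - 1) * e\<close>
      in absolute value.\<close>
    then have "(\<Sum>i\<in>{1..T}-{j}. ?h (u i) - ?h (v i)) = ?h (v j) - ?h (u j)"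
      using j by (simp add: sum_subtractf sum.remove[of _ j])
    moreover have "\<bar>\<Sum>i\<in>{1..T}-{j}. ?h (u i) - ?h (v i)\<bar> \<le> (\<Sum>i\<in>{1..T}-{j}. 2 * e)"
    proof (rule order_trans[OF sum_abs sum_mono])
      fix i assume i: "i \<in> {1..T} - {j}"
      then have "u i \<in> A i" "v i \<in> A i"
        using u v by (auto dest!: PiE_mem[of _ _ _ i])
      then show "\<bar>?h (u i) - ?h (v i)\<bar> \<le> 2 * e"
        using e[of i "u i"] e[of i "v i"] i by auto
    qed
    moreover have "(\<Sum>i\<in>{1..T}-{j}. 2 * e) = 2 * real T * e - 2 * e"
      using j by (simp add: of_nat_diff algebra_simps)
    moreover have "?h (v j) = real m - ?h y"
      using y bin[OF j] hamming_weight_complement by simp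
    moreover note e[OF j uj] e[OF j y(1)] gap
    ultimately show False
      by linarith
  qed
  show ?thesis
    unfolding uniquely_decodable_iff
  proof (intro ballI impI)
    fix u v
    assume u: "u \<in> (\<Pi>\<^sub>E i\<in>{1..T}. ?B i)" and v: "v \<in> (\<Pi>\<^sub>E i\<in>{1..T}. ?B i)"
      and eq: "\<forall>k\<in>{1..m}. (\<Sum>i=1..T. u i k) = (\<Sum>i=1..T. v i k)"
    have *: "u j \<in> A j \<or> u j \<in> ?c ` A j" "v j \<in> A j \<or> v j \<in> ?c ` A j"
      using u v j by (auto dest!: PiE_mem[of _ _ _ j])
    \<comment> \<open>The enlarged code differs from \<open>A\<close> only at \<open>j\<close>, so
      overwriting that entry by a word of \<open>A j\<close> gives a tuple of \<open>A\<close>.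
      Overwriting it by itself handles the case without complements.\<close>
    have upd: "z(j := x) \<in> (\<Pi>\<^sub>E i\<in>{1..T}. A i)" if "z \<in> (\<Pi>\<^sub>E i\<in>{1..T}. ?B i)" "x \<in> A j" for z x
      using that j by (auto simp: PiE_def Pi_def extensional_def split: if_splits)
    have sum_upd: "(\<Sum>i=1..T. (z(j := x)) i k) = (\<Sum>i=1..T. z i k) - z j k + x k"
      for z :: "nat \<Rightarrow> nat \<Rightarrow> int" and x k
      using j by (simp add: sum.remove[of _ j] fun_upd_def)
    consider "u j \<in> A j" "v j \<in> A j" | "u j \<in> A j" "v j \<in> ?c ` A j"
      | "u j \<in> ?c ` A j" "v j \<in> A j" | "u j \<in> ?c ` A j" "v j \<in> ?c ` A j"
      using * by blast
    then show "u = v"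
    proof cases
      case 1
      then show ?thesis
        using upd[OF u 1(1)] upd[OF v 1(2)] eq by (intro uniquely_decodableD[OF ud]) auto
    next
      case 2
      then show ?thesis
        using mixed[OF u v] eq by blast
    next
      case 3
      then show ?thesis
        using mixed[OF v u] eq by fastforce
    next
      case 4
      then obtain x y where x: "x \<in> A j" "u j = ?c x" and y: "y \<in> A j" "v j = ?c y"
        by blast
      \<comment> \<open>Adding \<open>x k + y k - 1\<close> to both sides turns
        \<open>1 - x k\<close> into \<open>y k\<close> and \<open>1 - y k\<close> into
        \<open>x k\<close>: the two words change sides uncomplemented.\<close>
      have "u(j := y) = v(j := x)"
      proof (rule uniquely_decodableD[OF ud upd[OF u y(1)] upd[OF v x(1)]])
        fix k assume "k \<in> {1..m}"
        then show "(\<Sum>i=1..T. (u(j := y)) i k) = (\<Sum>i=1..T. (v(j := x)) i k)"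
          using eq x y unfolding sum_upd by (simp add: complement_vector_def)
      qed
      then have "y = x" and "\<And>i. i \<noteq> j \<Longrightarrow> u i = v i"
        by (metis fun_upd_same, metis fun_upd_other)
      then show ?thesis
        using x y by (intro ext) metis
    qed
  qed
qed

text \<open>The weights of a word and its complement add up to \<open>m\<close>; if both were within
  \<open>e\<close> of \<open>w\<close>, then \<open>m\<close> would be within \<open>2 * e\<close>
  of \<open>2 * w\<close>.\<close>

lemma disjoint_complement:
  assumes A: "A \<subseteq> binary_vectors m"
    and e: "\<And>x. x \<in> A \<Longrightarrow> \<bar>real (hamming_weight m x) - w\<bar> \<le> e"
    and gap: "2 * e < \<bar>real m - 2 * w\<bar>"
  shows "A \<inter> complement_vector m ` A = {}"
proof -
  have "complement_vector m x \<notin> A" if "x \<in> A" for x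
  proof
    assume "complement_vector m x \<in> A"
    moreover have "x \<in> binary_vectors m"
      using A that by blast
    ultimately show False
      using e[OF that] e[of "complement_vector m x"] gap
      by (auto simp: hamming_weight_complement)
  qed
  then show ?thesis
    by blast
qed

subsection \<open>Products of codes\<close>

definition concat_vectors :: "nat \<Rightarrow> nat \<Rightarrow> (nat \<Rightarrow> int) \<Rightarrow> (nat \<Rightarrow> int) \<Rightarrow> nat \<Rightarrow> int" where
  "concat_vectors m d x y = (\<lambda>k\<in>{1..m+d}. if k \<le> m then x k else y (k - m))"

definition concat_code :: "nat \<Rightarrow> nat \<Rightarrow> (nat \<Rightarrow> int) set \<Rightarrow> (nat \<Rightarrow> int) set \<Rightarrow> (nat \<Rightarrow> int) set" where
  "concat_code m d A B = (\<lambda>(x, y). concat_vectors m d x y) ` (A \<times> B)"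

text \<open>The everywhere undefined function is the only element of
  \<open>binary_vectors 0\<close>, that is, the empty word; the zeroth power therefore has exactly
  one word.\<close>

fun code_power :: "nat \<Rightarrow> (nat \<Rightarrow> int) set \<Rightarrow> nat \<Rightarrow> (nat \<Rightarrow> int) set" where
  "code_power d A 0 = {\<lambda>_. undefined}"
| "code_power d A (Suc n) = concat_code (d * n) d (code_power d A n) A"

lemma concat_vectors_left:
  assumes "x \<in> binary_vectors m"
  shows "(\<lambda>k\<in>{1..m}. concat_vectors m d x y k) = x"
  using assms by (auto simp: concat_vectors_def binary_vectors_def fun_eq_iff PiE_iff extensional_def)

lemma concat_vectors_right:
  assumes "y \<in> binary_vectors d"
  shows "(\<lambda>k\<in>{1..d}. concat_vectors m d x y (m + k)) = y"
  using assms by (auto simp: concat_vectors_def binary_vectors_def fun_eq_iff PiE_iff extensional_def)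

lemma inj_on_concat_vectors:
  assumes "A \<subseteq> binary_vectors m" and "B \<subseteq> binary_vectors d"
  shows "inj_on (\<lambda>(x, y). concat_vectors m d x y) (A \<times> B)"
proof (rule inj_on_inverseI)
  fix p assume "p \<in> A \<times> B"
  then show "(\<lambda>z. (\<lambda>k\<in>{1..m}. z k, \<lambda>k\<in>{1..d}. z (m + k))) ((\<lambda>(x, y). concat_vectors m d x y) p) = p"
    using assms by (auto simp: concat_vectors_left concat_vectors_right subset_iff simp del: One_nat_def)
qed

lemma concat_vectors_binary:
  assumes "x \<in> binary_vectors m" and "y \<in> binary_vectors d"
  shows "concat_vectors m d x y \<in> binary_vectors (m + d)"
  unfolding binary_vectors_def
proof (rule PiE_I)
  fix k assume k: "k \<in> {1..m+d}"
  show "concat_vectors m d x y k \<in> {0, 1}"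
  proof (cases "k \<le> m")
    case True
    then have "x k \<in> {0, 1}"
      using assms(1) k by (auto simp: binary_vectors_def PiE_iff)
    then show ?thesis
      using k True by (simp add: concat_vectors_def)
  next
    case False
    with k have "k - m \<in> {1..d}"
      by auto
    then have "y (k - m) \<in> {0, 1}"
      by (rule PiE_mem[OF assms(2)[unfolded binary_vectors_def]])
    then show ?thesis
      using k False by (simp add: concat_vectors_def)
  qed
qed (auto simp: concat_vectors_def)

lemma hamming_weight_concat:
  assumes "x \<in> binary_vectors m" and "y \<in> binary_vectors d"
  shows "hamming_weight (m + d) (concat_vectors m d x y) = hamming_weight m x + hamming_weight d y"
proof -
  have "(\<Sum>k=1..m+d. concat_vectors m d x y k) =
      (\<Sum>k=1..m. concat_vectors m d x y k) + (\<Sum>k=m+1..m+d. concat_vectors m d x y k)"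
    by (intro sum.ub_add_nat) simp
  also have "(\<Sum>k=m+1..m+d. concat_vectors m d x y k) = (\<Sum>k=1..d. concat_vectors m d x y (k + m))"
    using sum.shift_bounds_cl_nat_ivl[of "concat_vectors m d x y" 1 m d] by (simp add: add.commute)
  finally have "(\<Sum>k=1..m+d. concat_vectors m d x y k) = (\<Sum>k=1..m. x k) + (\<Sum>k=1..d. y k)"
    by (simp add: concat_vectors_def)
  then show ?thesis
    unfolding hamming_weight_binary[OF concat_vectors_binary[OF assms], symmetric]
      hamming_weight_binary[OF assms(1), symmetric] hamming_weight_binary[OF assms(2), symmetric]
    by linarith
qed

lemma concat_code_binary:
  assumes "A \<subseteq> binary_vectors m" and "B \<subseteq> binary_vectors d"
  shows "concat_code m d A B \<subseteq> binary_vectors (m + d)"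
  using assms unfolding concat_code_def by (auto intro!: concat_vectors_binary)

text \<open>The first \<open>m\<close> and the last \<open>d\<close> coordinates of the received
  vector are decoded independently.\<close>

lemma uniquely_decodable_concat:
  assumes A: "user_code m T A" "uniquely_decodable m T A"
    and B: "user_code d T B" "uniquely_decodable d T B"
  shows "uniquely_decodable (m + d) T (\<lambda>i. concat_code m d (A i) (B i))"
  unfolding uniquely_decodable_iff
proof (intro ballI impI)
  fix u v
  assume u: "u \<in> (\<Pi>\<^sub>E i\<in>{1..T}. concat_code m d (A i) (B i))"
    and v: "v \<in> (\<Pi>\<^sub>E i\<in>{1..T}. concat_code m d (A i) (B i))"
    and eq: "\<forall>k\<in>{1..m+d}. (\<Sum>i=1..T. u i k) = (\<Sum>i=1..T. v i k)"
  \<comment> \<open>The tuples of left and right blocks are restricted in both the user and the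
    coordinate, so that they are extensional tuples of extensional words.\<close>
  define l where "l z = (\<lambda>i\<in>{1..T}. \<lambda>k\<in>{1..m}. z i k)" for z :: "nat \<Rightarrow> nat \<Rightarrow> int"
  define r where "r z = (\<lambda>i\<in>{1..T}. \<lambda>k\<in>{1..d}. z i (m + k))" for z :: "nat \<Rightarrow> nat \<Rightarrow> int"
  have split: "l z i \<in> A i \<and> r z i \<in> B i \<and> z i = concat_vectors m d (l z i) (r z i)"
    if "z \<in> (\<Pi>\<^sub>E i\<in>{1..T}. concat_code m d (A i) (B i))" "i \<in> {1..T}" for z i
  proof -
    have "z i \<in> concat_code m d (A i) (B i)"
      using that by (rule PiE_mem)
    then obtain a b where "a \<in> A i" "b \<in> B i" "z i = concat_vectors m d a b"
      by (auto simp: concat_code_def)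
    moreover from this have "a \<in> binary_vectors m" "b \<in> binary_vectors d"
      using A(1) B(1) that(2) by (auto simp: user_code_def)
    ultimately show ?thesis
      using that(2) unfolding l_def r_def
      by (simp add: concat_vectors_left concat_vectors_right del: One_nat_def)
  qed
  have "l u = l v"
  proof (rule uniquely_decodableD[OF A(2)])
    show "l u \<in> (\<Pi>\<^sub>E i\<in>{1..T}. A i)" "l v \<in> (\<Pi>\<^sub>E i\<in>{1..T}. A i)"
      using split[OF u] split[OF v] by (auto simp: l_def)
    show "(\<Sum>i=1..T. l u i k) = (\<Sum>i=1..T. l v i k)" if "k \<in> {1..m}" for k
      using that eq by (simp add: l_def)
  qed
  moreover have "r u = r v"
  proof (rule uniquely_decodableD[OF B(2)])
    show "r u \<in> (\<Pi>\<^sub>E i\<in>{1..T}. B i)" "r v \<in> (\<Pi>\<^sub>E i\<in>{1..T}. B i)"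
      using split[OF u] split[OF v] by (auto simp: r_def)
    show "(\<Sum>i=1..T. r u i k) = (\<Sum>i=1..T. r v i k)" if "k \<in> {1..d}" for k
      using that eq by (simp add: r_def)
  qed
  ultimately show "u = v"
    using split[OF u] split[OF v] by (intro PiE_ext[OF u v]) metis
qed

lemma code_power_binary:
  assumes "A \<subseteq> binary_vectors d"
  shows "code_power d A n \<subseteq> binary_vectors (d * n)"
proof (induction n)
  case 0
  show ?case by (simp add: binary_vectors_def)
next
  case (Suc n)
  show ?case
    using concat_code_binary[OF Suc assms] by (simp add: add.commute)
qed

lemma uniquely_decodable_code_power:
  assumes "user_code d T C" and "uniquely_decodable d T C"
  shows "uniquely_decodable (d * n) T (\<lambda>i. code_power d (C i) n)"
proof (induction n)
  \<comment> \<open>All constituents are the same singleton, so there is only one tuple, although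
    the equation of sums is vacuous.\<close>
  case 0
  show ?case
    unfolding uniquely_decodable_iff by (auto intro!: PiE_ext)
next
  case (Suc n)
  have "user_code (d * n) T (\<lambda>i. code_power d (C i) n)"
    using assms(1) code_power_binary by (auto simp: user_code_def)
  then show ?case
    using uniquely_decodable_concat[OF _ Suc assms] by (simp add: add.commute)
qed

text \<open>Concatenation is injective on pairs. This one recursion yields both the cardinality,
  with \<open>f\<close> constant \<open>1\<close>, and the weight moments.\<close>

lemma sum_code_power_Suc:
  assumes "A \<subseteq> binary_vectors d"
  shows "(\<Sum>z\<in>code_power d A (Suc n). f z) =
    (\<Sum>x\<in>code_power d A n. \<Sum>y\<in>A. f (concat_vectors (d * n) d x y))"
  using inj_on_concat_vectors[OF code_power_binary[OF assms] assms]
  by (simp add: concat_code_def sum.reindex sum.cartesian_product case_prod_unfold)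

lemma card_code_power:
  assumes "A \<subseteq> binary_vectors d"
  shows "card (code_power d A n) = card A ^ n"
proof (induction n)
  case (Suc n)
  then show ?case
    using sum_code_power_Suc[OF assms, of "\<lambda>_. 1::nat" n] by simp
qed simp

subsection \<open>Weight concentration\<close>

text \<open>For a uniformly random word the weight is a sum of \<open>n\<close> independent block
  weights with mean \<open>w\<close>, so variances add, and each is at most \<open>d\<close>
  squared. The moments are left as sums over the code, whence the factor
  \<open>card A ^ n\<close>.\<close>

lemma weight_moments_code_power:
  assumes A: "A \<subseteq> binary_vectors d" "A \<noteq> {}"
  defines "w \<equiv> average_weight d A"
  shows "(\<Sum>x\<in>code_power d A n. real (hamming_weight (d * n) x) - real n * w) = 0 \<and>
    (\<Sum>x\<in>code_power d A n. (real (hamming_weight (d * n) x) - real n * w)\<^sup>2)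
      \<le> real n * (real d)\<^sup>2 * real (card A ^ n)"
proof (induction n)
  case 0
  have "hamming_weight 0 x = 0" for x
    using hamming_weight_le[of 0 x] by simp
  then show ?case
    by simp
next
  case (Suc n)
  let ?P = "code_power d A n"
  define p where "p x = real (hamming_weight (d * n) x) - real n * w" for x
  define q where "q y = real (hamming_weight d y) - w" for y
  have pq: "real (hamming_weight (d * Suc n) (concat_vectors (d * n) d x y)) - real (Suc n) * w = p x + q y"
    if "x \<in> ?P" "y \<in> A" for x y
  proof -
    have "x \<in> binary_vectors (d * n)" "y \<in> binary_vectors d"
      using subsetD[OF code_power_binary[OF A(1)] that(1)] subsetD[OF A(1) that(2)] .
    from hamming_weight_concat[OF this] show ?thesis
      by (simp add: p_def q_def algebra_simps)
  qed
  have "finite A"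
    using A(1) finite_binary_vectors by (rule finite_subset)
  with A have cA: "card A > 0"
    by (simp add: card_gt_0_iff)
  have P: "(\<Sum>x\<in>?P. p x) = 0" "(\<Sum>x\<in>?P. (p x)\<^sup>2) \<le> real n * (real d)\<^sup>2 * real (card A ^ n)"
    using Suc by (simp_all add: p_def)
  have Q: "(\<Sum>y\<in>A. q y) = 0"
    using cA by (simp add: q_def w_def average_weight_def sum_subtractf)
  \<comment> \<open>Both a block weight and its mean lie between \<open>0\<close> and
    \<open>d\<close>, which gives the crude variance bound.\<close>
  have "0 \<le> w" "w \<le> real d"
    using cA hamming_weight_le sum_bounded_above[of A "\<lambda>y. real (hamming_weight d y)" "real d"]
    by (auto simp: w_def average_weight_def sum_nonneg field_simps)
  then have "\<bar>q y\<bar> \<le> real d" for y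
    using hamming_weight_le[of d y] by (auto simp: q_def)
  then have q2: "(q y)\<^sup>2 \<le> (real d)\<^sup>2" for y
    by (metis abs_ge_zero power2_abs power_mono)
  have "(\<Sum>z\<in>code_power d A (Suc n). (real (hamming_weight (d * Suc n) z) - real (Suc n) * w)\<^sup>2)
      = (\<Sum>x\<in>?P. \<Sum>y\<in>A. (p x + q y)\<^sup>2)"
    unfolding sum_code_power_Suc[OF A(1)] by (intro sum.cong refl) (simp only: pq)
  also have "\<dots> = (\<Sum>x\<in>?P. real (card A) * (p x)\<^sup>2 + (\<Sum>y\<in>A. (q y)\<^sup>2))"
  proof (rule sum.cong[OF refl])
    fix x
    \<comment> \<open>The cross term vanishes because the deviation \<open>q\<close> of the last
      block is centred.\<close>
    have "(\<Sum>y\<in>A. 2 * p x * q y) = 0"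
      unfolding sum_distrib_left[symmetric] Q by simp
    then show "(\<Sum>y\<in>A. (p x + q y)\<^sup>2) = real (card A) * (p x)\<^sup>2 + (\<Sum>y\<in>A. (q y)\<^sup>2)"
      by (simp add: power2_sum sum.distrib)
  qed
  also have "\<dots> = real (card A) * (\<Sum>x\<in>?P. (p x)\<^sup>2) + real (card ?P) * (\<Sum>y\<in>A. (q y)\<^sup>2)"
    by (simp only: sum.distrib sum_distrib_left sum_constant)
  also have "\<dots> \<le> real (card A) * (real n * (real d)\<^sup>2 * real (card A ^ n)) +
      real (card ?P) * (real (card A) * (real d)\<^sup>2)"
    using P q2 by (intro add_mono mult_left_mono sum_bounded_above) auto
  also have "\<dots> = real (Suc n) * (real d)\<^sup>2 * real (card A ^ Suc n)"
    by (simp add: card_code_power[OF A(1)] algebra_simps)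
  finally have second: "(\<Sum>z\<in>code_power d A (Suc n).
      (real (hamming_weight (d * Suc n) z) - real (Suc n) * w)\<^sup>2) \<le> \<dots>" .
  have "(\<Sum>z\<in>code_power d A (Suc n). real (hamming_weight (d * Suc n) z) - real (Suc n) * w)
      = (\<Sum>x\<in>?P. \<Sum>y\<in>A. p x + q y)"
    unfolding sum_code_power_Suc[OF A(1)] by (intro sum.cong refl) (simp only: pq)
  also have "\<dots> = real (card A) * (\<Sum>x\<in>?P. p x)"
    by (simp add: sum.distrib sum_distrib_left Q)
  finally show ?case
    using second P(1) by simp
qed

text \<open>The tolerance is linear in \<open>n\<close>, whereas the standard deviation grows only
  like the square root of \<open>n\<close>.\<close>

definition typical_code :: "nat \<Rightarrow> (nat \<Rightarrow> int) set \<Rightarrow> nat \<Rightarrow> real \<Rightarrow> (nat \<Rightarrow> int) set" where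
  "typical_code d A n \<epsilon> = {x \<in> code_power d A n.
    \<bar>real (hamming_weight (d * n) x) - real n * average_weight d A\<bar> \<le> \<epsilon> * real n}"

text \<open>Chebyshev's inequality by counting: each atypical word contributes at least
  \<open>(\<epsilon> * real n)\<^sup>2\<close> to the second moment.\<close>

lemma card_typical_code:
  assumes A: "A \<subseteq> binary_vectors d" "A \<noteq> {}" and "\<epsilon> > 0" "n > 0"
  shows "(1 - (real d)\<^sup>2 / (\<epsilon>\<^sup>2 * real n)) * real (card A ^ n) \<le> real (card (typical_code d A n \<epsilon>))"
proof -
  let ?P = "code_power d A n"
  let ?dev = "\<lambda>x. real (hamming_weight (d * n) x) - real n * average_weight d A"
  let ?bad = "?P - typical_code d A n \<epsilon>"
  have fin: "finite ?P"
    using code_power_binary[OF A(1)] finite_binary_vectors by (rule finite_subset)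
  have "real (card ?bad) * (\<epsilon> * real n)\<^sup>2 \<le> (\<Sum>x\<in>?bad. (?dev x)\<^sup>2)"
  proof (rule sum_bounded_below)
    fix x assume "x \<in> ?bad"
    then have "\<epsilon> * real n \<le> \<bar>?dev x\<bar>"
      by (auto simp: typical_code_def)
    then have "(\<epsilon> * real n)\<^sup>2 \<le> \<bar>?dev x\<bar>\<^sup>2"
      using assms by (intro power_mono) auto
    then show "(\<epsilon> * real n)\<^sup>2 \<le> (?dev x)\<^sup>2"
      by simp
  qed
  also have "\<dots> \<le> (\<Sum>x\<in>?P. (?dev x)\<^sup>2)"
    using fin by (intro sum_mono2) auto
  also have "\<dots> \<le> real n * (real d)\<^sup>2 * real (card A ^ n)"
    using weight_moments_code_power[OF A] by blast
  finally have "real (card ?bad) \<le> (real d)\<^sup>2 / (\<epsilon>\<^sup>2 * real n) * real (card A ^ n)"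
    using assms by (simp add: field_simps power2_eq_square)
  \<comment> \<open>The second fact keeps the natural-number subtraction from truncating when it is
    moved to the reals.\<close>
  moreover have "card ?bad = card A ^ n - card (typical_code d A n \<epsilon>)"
      and "card (typical_code d A n \<epsilon>) \<le> card A ^ n"
    using fin by (auto simp: typical_code_def card_code_power[OF A(1), symmetric]
        intro!: card_Diff_subset card_mono intro: finite_subset)
  ultimately show ?thesis
    by (simp add: of_nat_diff algebra_simps)
qed

section \<open>Choice of parameters and comparison of sum rates\<close>

theorem theorem1:
  fixes T d :: nat and C :: "nat \<Rightarrow> (nat \<Rightarrow> int) set" and R :: real
  assumes "T \<ge> 1" and "d \<ge> 1"
    and "user_code d T C"
    and "\<forall>i\<in>{1..T}. C i \<noteq> {}"
    and "uniquely_decodable d T C"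
    and "sum_rate d T C = R"
    and "\<exists>j\<in>{1..T}. average_weight d (C j) \<noteq> real d / 2"
  shows "\<exists>(n::nat) (C' :: nat \<Rightarrow> (nat \<Rightarrow> int) set).
    n > 0 \<and> user_code (d * n) T C' \<and> uniquely_decodable (d * n) T C' \<and>
    sum_rate (d * n) T C' > R"
proof -
  obtain j where j: "j \<in> {1..T}" "average_weight d (C j) \<noteq> real d / 2"
    using assms(7) by blast
  define w where "w i = average_weight d (C i)" for i
  define g where "g = \<bar>real d - 2 * w j\<bar>"
  \<comment> \<open>With this tolerance the \<open>T\<close> users together can shift the weight by
    at most \<open>2 * T * \<epsilon> * n\<close>, which is half of the available gap
    \<open>n * g\<close>.\<close>
  define \<epsilon> where "\<epsilon> = g / (4 * real T)"
  have g: "g > 0"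
    using j by (auto simp: g_def w_def)
  then have \<epsilon>: "\<epsilon> > 0"
    using assms(1) by (simp add: \<epsilon>_def)
  \<comment> \<open>The bound on \<open>n\<close> is exactly the condition
    \<open>T * \<delta> < 1 / 2\<close> for the Chebyshev bound \<open>\<delta>\<close> on the
    fraction of atypical words.\<close>
  obtain n :: nat where n: "2 * real T * (real d)\<^sup>2 / \<epsilon>\<^sup>2 < real n"
    using reals_Archimedean2 by blast
  have "0 \<le> 2 * real T * (real d)\<^sup>2 / \<epsilon>\<^sup>2"
    by simp
  then have n0: "n > 0"
    using n by linarith
  define \<delta> where "\<delta> = (real d)\<^sup>2 / (\<epsilon>\<^sup>2 * real n)"
  have \<delta>: "0 \<le> \<delta>" "real T * \<delta> < 1 / 2"
    using n \<epsilon> n0 by (simp_all add: \<delta>_def field_simps)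
  have "\<delta> \<le> real T * \<delta>"
    using assms(1) \<delta>(1) by (simp add: mult_left_le_one_le mult_le_cancel_right1)
  with \<delta> have \<delta>1: "\<delta> < 1"
    by linarith
  define A where "A i = typical_code d (C i) n \<epsilon>" for i
  let ?m = "d * n"
  let ?D = "A(j := A j \<union> complement_vector ?m ` A j)"
  have C: "C i \<subseteq> binary_vectors d" "C i \<noteq> {}" if "i \<in> {1..T}" for i
    using assms(3,4) that by (auto simp: user_code_def)
  have A: "A i \<subseteq> binary_vectors ?m" if "i \<in> {1..T}" for i
    using code_power_binary[OF C(1)[OF that]] by (auto simp: A_def typical_code_def)
  then have codeA: "user_code ?m T A"
    by (simp add: user_code_def)
  have udA: "uniquely_decodable ?m T A"
    using uniquely_decodable_code_power[OF assms(3,5)]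
    by (rule uniquely_decodable_mono) (auto simp: A_def typical_code_def)
  have dev: "\<bar>real (hamming_weight ?m x) - real n * w i\<bar> \<le> \<epsilon> * real n"
    if "x \<in> A i" for i x
    using that by (simp add: A_def typical_code_def w_def)
  have "real ?m - 2 * (real n * w j) = real n * (real d - 2 * w j)"
    by (simp add: algebra_simps)
  then have gn: "\<bar>real ?m - 2 * (real n * w j)\<bar> = real n * g"
    by (simp add: g_def abs_mult)
  have Te: "2 * real T * (\<epsilon> * real n) = real n * g / 2"
    using assms(1) by (simp add: \<epsilon>_def)
  have gap: "2 * real T * (\<epsilon> * real n) < \<bar>real ?m - 2 * (real n * w j)\<bar>"
    unfolding gn Te using g n0 by simp
  \<comment> \<open>Since \<open>T \<ge> 1\<close>, the gap for decoding also gives the smaller gap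
    that separates \<open>A j\<close> from its complements.\<close>
  have "1 * (\<epsilon> * real n) \<le> real T * (\<epsilon> * real n)"
    using assms(1) \<epsilon> by (intro mult_right_mono) auto
  with gap have gap1: "2 * (\<epsilon> * real n) < \<bar>real ?m - 2 * (real n * w j)\<bar>"
    by linarith
  have codeD: "user_code ?m T ?D"
    using A j(1) complement_binary by (auto simp: user_code_def)
  have udD: "uniquely_decodable ?m T ?D"
    using uniquely_decodable_Un_complement[where w = "\<lambda>i. real n * w i", OF codeA udA j(1) dev gap] .
  have cardD: "card (?D j) = 2 * card (A j)"
    using card_Un_complement[OF A[OF j(1)] disjoint_complement[OF A[OF j(1)] dev gap1]] by simp
  let ?p = "\<Prod>i=1..T. real (card (C i))"
  have p: "?p > 0"
  proof (rule prod_pos)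
    fix i assume "i \<in> {1..T}"
    with C finite_subset[OF C(1) finite_binary_vectors] show "0 < real (card (C i))"
      by (simp add: card_gt_0_iff)
  qed
  \<comment> \<open>By Bernoulli's inequality, restricting all \<open>T\<close> constituents to
    typical words keeps more than half of the tuples, so doubling constituent \<open>j\<close>
    outweighs the loss.\<close>
  have "1 - real T * \<delta> \<le> (1 - \<delta>) ^ T"
    using Bernoulli_inequality[of "- \<delta>" T] \<delta>1 by simp
  then have "1 < 2 * (1 - \<delta>) ^ T"
    using \<delta>(2) by linarith
  then have "1 * ?p ^ n < 2 * (1 - \<delta>) ^ T * ?p ^ n"
    using p by (intro mult_strict_right_mono) auto
  also have "\<dots> = 2 * (\<Prod>i=1..T. (1 - \<delta>) * real (card (C i) ^ n))"
    by (simp add: prod.distrib prod_power_distrib)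
  also have "\<dots> \<le> 2 * (\<Prod>i=1..T. real (card (A i)))"
    using card_typical_code[OF C \<epsilon> n0] \<delta>1
    by (intro mult_left_mono prod_mono) (auto simp: A_def \<delta>_def)
  also have "\<dots> = (\<Prod>i=1..T. real (card (?D i)))"
    using j(1) cardD by (simp add: prod.remove[of _ j])
  finally have "log 2 (?p ^ n) < log 2 (\<Prod>i=1..T. real (card (?D i)))"
    using p by (subst log_less_cancel_iff) (auto intro: less_trans[of _ "?p ^ n"])
  then have "real n * log 2 ?p < log 2 (\<Prod>i=1..T. real (card (?D i)))"
    using p by (simp add: log_nat_power)
  \<comment> \<open>Dividing by \<open>d * n\<close> turns \<open>real n * log 2 ?p\<close> into the
    old rate.\<close>
  then have "sum_rate d T C < sum_rate ?m T ?D"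
    using assms(2) n0 unfolding sum_rate_def by (simp add: field_simps)
  with n0 codeD udD assms(6) show ?thesis
    by blast
qed

end
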